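(* Every core-compact open well-filtered $T_0$ space is sober.
   Context: Let $X$ be a $T_0$ space and $\mathcal O(X)$ the set of all open subsets of $X$. For $A,B\subseteq X$, write $A\ll B$ if $A\subseteq B$ and every cover of $B$ by open subsets of $X$ contains a finite subfamily covering $A$. A nonempty family $\mathcal A$ of subsets of $X$ is $\ll$-filtered if for all $A_1,A_2\in\mathcal A$ there is $A_3\in\mathcal A$ with $A_3\ll A_1$ and $A_3\ll A_2$. $X$ is open well-filtered if for every $\ll$-filtered family $\{U_i:i\in I\}\subseteq\mathcal O(X)$ and every $U\in\mathcal O(X)$, $\bigcap_{i\in I}U_i\subseteq U$ implies $U_{i_0}\subseteq U$ for some $i_0\in I$. $X$ is core-compact if for every $x\in X$ and every open $U$ with $x\in U$ there is an open $V$ with $x\in V\ll U$. A nonempty subset $A$ of $X$ is irreducible if for any closed sets $F_1,F_2$, $A\subseteq F_1\cup F_2$ implies $A\subseteq F_1$ or $A\subseteq F_2$. A $T_0$ space $X$ is sober if every irreducible closed set $F$ is the closure of a point, i.e. $F=\mathrm{cl}(\{x\})$ for some $x\in X$. *)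

theory Defs
  imports "HOL-Analysis.Abstract_Topological_Spaces"
begin

text \<open>The carrier of a space \<open>X\<close> is \<open>topspace X\<close>. The relation \<open>A \<ll> B\<close>
  is meant for subsets of the carrier only; the guard \<open>B \<subseteq> topspace X\<close> excludes sets outside
  the carrier, which have no open cover at all.\<close>

definition rel_compact_in :: "'a topology \<Rightarrow> 'a set \<Rightarrow> 'a set \<Rightarrow> bool" where
  "rel_compact_in X A B \<longleftrightarrow>
     A \<subseteq> B \<and> B \<subseteq> topspace X \<and>
     (\<forall>\<C>. (\<forall>U\<in>\<C>. openin X U) \<and> B \<subseteq> \<Union>\<C> \<longrightarrow>
          (\<exists>\<D>. finite \<D> \<and> \<D> \<subseteq> \<C> \<and> A \<subseteq> \<Union>\<D>))"

definition rel_compact_filtered :: "'a topology \<Rightarrow> 'a set set \<Rightarrow> bool" where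
  "rel_compact_filtered X \<A> \<longleftrightarrow>
     \<A> \<noteq> {} \<and>
     (\<forall>A1\<in>\<A>. \<forall>A2\<in>\<A>. \<exists>A3\<in>\<A>. rel_compact_in X A3 A1 \<and> rel_compact_in X A3 A2)"

definition open_well_filtered :: "'a topology \<Rightarrow> bool" where
  "open_well_filtered X \<longleftrightarrow>
     (\<forall>\<U> U. (\<forall>V\<in>\<U>. openin X V) \<and> rel_compact_filtered X \<U> \<and> openin X U \<and> \<Inter>\<U> \<subseteq> U \<longrightarrow>
        (\<exists>V\<in>\<U>. V \<subseteq> U))"

definition core_compact :: "'a topology \<Rightarrow> bool" where
  "core_compact X \<longleftrightarrow>
     (\<forall>x U. openin X U \<and> x \<in> U \<longrightarrow> (\<exists>V. openin X V \<and> x \<in> V \<and> rel_compact_in X V U))"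

definition irreducible_in :: "'a topology \<Rightarrow> 'a set \<Rightarrow> bool" where
  "irreducible_in X A \<longleftrightarrow>
     A \<subseteq> topspace X \<and> A \<noteq> {} \<and>
     (\<forall>F1 F2. closedin X F1 \<and> closedin X F2 \<and> A \<subseteq> F1 \<union> F2 \<longrightarrow> A \<subseteq> F1 \<or> A \<subseteq> F2)"

definition sober_space :: "'a topology \<Rightarrow> bool" where
  "sober_space X \<longleftrightarrow>
     t0_space X \<and>
     (\<forall>F. closedin X F \<and> irreducible_in X F \<longrightarrow> (\<exists>x\<in>topspace X. F = X closure_of {x}))"

end

theory Submission
  imports Defs
begin

text \<open>For an irreducible closed set \<open>F\<close>, the open sets meeting \<open>F\<close> are closed under binary
  intersections, hence \<open>\<ll>\<close>-filtered by core-compactness. None of them is contained in the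
  complement of \<open>F\<close>, so by open well-filteredness their intersection contains a point of \<open>F\<close>,
  and such a point is dense in \<open>F\<close>.\<close>

lemma rel_compact_in_mono:
  assumes "rel_compact_in X A B" "B \<subseteq> C" "C \<subseteq> topspace X"
  shows "rel_compact_in X A C"
  using assms unfolding rel_compact_in_def by (meson subset_trans)

text \<open>Pass to complements: if \<open>U \<inter> V\<close> missed \<open>A\<close>, the closed
  complements of \<open>U\<close> and \<open>V\<close> would cover \<open>A\<close>, so by
  irreducibility one of them would contain \<open>A\<close>.\<close>

lemma irreducible_in_Int_open:
  assumes "irreducible_in X A" "openin X U" "openin X V" "U \<inter> A \<noteq> {}" "V \<inter> A \<noteq> {}"
  shows "U \<inter> V \<inter> A \<noteq> {}"
proof
  assume "U \<inter> V \<inter> A = {}"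
  moreover have "A \<subseteq> topspace X"
    using assms(1) by (simp add: irreducible_in_def)
  ultimately have "A \<subseteq> (topspace X - U) \<union> (topspace X - V)"
    by blast
  then have "A \<subseteq> topspace X - U \<or> A \<subseteq> topspace X - V"
    using assms(1-3) unfolding irreducible_in_def by (meson closedin_diff closedin_topspace)
  then show False
    using assms(4,5) by blast
qed

lemma rel_compact_filtered_open_meeting_irreducible:
  assumes "core_compact X" "irreducible_in X F"
  shows "rel_compact_filtered X {U. openin X U \<and> U \<inter> F \<noteq> {}}"
  unfolding rel_compact_filtered_def
proof (intro conjI ballI)
  have "topspace X \<inter> F \<noteq> {}"
    using assms(2) by (auto simp: irreducible_in_def)
  then show "{U. openin X U \<and> U \<inter> F \<noteq> {}} \<noteq> {}"
    by blast
next
  fix U V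
  assume "U \<in> {U. openin X U \<and> U \<inter> F \<noteq> {}}" "V \<in> {U. openin X U \<and> U \<inter> F \<noteq> {}}"
  then have U: "openin X U" "U \<inter> F \<noteq> {}" and V: "openin X V" "V \<inter> F \<noteq> {}"
    by auto
  \<comment> \<open>The point is chosen inside \<open>F\<close> so that the neighbourhood
    \<open>W\<close> of \<open>x\<close> given by core-compactness again meets \<open>F\<close> and
    belongs to the family.\<close>
  then obtain x where x: "x \<in> U \<inter> V" "x \<in> F"
    using irreducible_in_Int_open[OF assms(2)] by blast
  then obtain W where W: "openin X W" "x \<in> W" "rel_compact_in X W (U \<inter> V)"
    using assms(1) U V unfolding core_compact_def by (metis openin_Int)
  then have "rel_compact_in X W U" "rel_compact_in X W V"
    using U V by (meson rel_compact_in_mono[OF W(3)] Int_lower1 Int_lower2 openin_subset)+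
  then show "\<exists>W\<in>{U. openin X U \<and> U \<inter> F \<noteq> {}}. rel_compact_in X W U \<and> rel_compact_in X W V"
    using W x by blast
qed

theorem theorem4p7:
  fixes X :: "'a topology"
  assumes "t0_space X"
    and "core_compact X"
    and "open_well_filtered X"
  shows "sober_space X"
  unfolding sober_space_def
proof (intro conjI allI impI)
  show "t0_space X" by fact
next
  fix F
  assume "closedin X F \<and> irreducible_in X F"
  then have F: "closedin X F" "irreducible_in X F" by auto
  let ?\<U> = "{U. openin X U \<and> U \<inter> F \<noteq> {}}"
  have "\<not> \<Inter>?\<U> \<subseteq> topspace X - F"
  proof
    assume "\<Inter>?\<U> \<subseteq> topspace X - F"
    moreover have "openin X (topspace X - F)"
      using F(1) by blast
    ultimately have "\<exists>V\<in>?\<U>. V \<subseteq> topspace X - F"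
      using assms(3) rel_compact_filtered_open_meeting_irreducible[OF assms(2) F(2)]
      unfolding open_well_filtered_def by (metis (no_types, lifting) mem_Collect_eq)
    then show False by blast
  qed
  \<comment> \<open>This membership keeps the intersection inside the carrier, so a point of it
    outside \<open>topspace X - F\<close> must lie in \<open>F\<close>.\<close>
  moreover have "topspace X \<in> ?\<U>"
    using F(2) by (auto simp: irreducible_in_def)
  ultimately obtain x where x: "x \<in> F" "x \<in> topspace X" "\<forall>U\<in>?\<U>. x \<in> U"
    by blast
  have "X closure_of {x} \<subseteq> F"
    using F(1) x(1) by (simp add: closure_of_minimal)
  moreover have "F \<subseteq> X closure_of {x}"
  proof
    fix y
    assume "y \<in> F"
    \<comment> \<open>Such a \<open>T\<close> meets \<open>F\<close> in \<open>y\<close>, hence is a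
      member of the family and contains \<open>x\<close>.\<close>
    then have "x \<in> T" if "openin X T" "y \<in> T" for T
      using x(3) that by blast
    moreover have "y \<in> topspace X"
      using \<open>y \<in> F\<close> closedin_subset[OF F(1)] by blast
    ultimately show "y \<in> X closure_of {x}"
      by (simp add: in_closure_of)
  qed
  ultimately show "\<exists>x\<in>topspace X. F = X closure_of {x}"
    using x(2) by blast
qed

end
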